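(* Let $k \geq 2$ and let $Z_k(\tau)$ be a nontrivial deformation of $Z_k$. Then $Z_k(\tau)$ contains no compact complex analytic curves.
   Context: For an integer $k \geq 1$, $Z_k = \operatorname{Tot}(\mathcal O_{\mathbb P^1}(-k))$ is covered by two charts $U = \mathbb C^2_{z,u}$ and $V = \mathbb C^2_{\xi,v}$ with $U \cap V \simeq \mathbb C^* \times \mathbb C$ and $(\xi, v) = (z^{-1}, z^k u)$. For $(t_1,\dots,t_{k-1}) \in \mathbb C^{k-1}$ let $\tau \in H^1(Z_k, \mathcal T_{Z_k})$ be the class of the 1-cocycle $\sum_{i=1}^{k-1} t_i z^{-k+i}\frac{\partial}{\partial u}$ (in $U$-coordinates); this gives an isomorphism $\mathbb C^{k-1} \simeq H^1(Z_k, \mathcal T_{Z_k})$. The deformation $Z_k(\tau)$ is the complex surface obtained by gluing $U = \mathbb C^2_{z,u}$ and $V = \mathbb C^2_{\xi,v}$ along $U \cap V \simeq \mathbb C^* \times \mathbb C$ by $$(\xi, v) = \Big(z^{-1},\ z^k u + \sum_{i=1}^{k-1} t_i z^i\Big).$$ Only deformations of $Z_k$ of this form are considered. The deformation $Z_k(\tau)$ is called nontrivial if $\tau \neq 0$, i.e. if $(t_1,\dots,t_{k-1}) \neq 0$. *)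

theory Defs
  imports "HOL-Analysis.Analysis"
begin

section \<open>Analytic subsets of the complex plane of dimension two\<close>

text \<open>Complex differentiability: the real Frechet derivative is given by a complex-linear form.\<close>

definition has_complex_gradient ::
    "(complex \<times> complex \<Rightarrow> complex) \<Rightarrow> complex \<times> complex \<Rightarrow> complex \<times> complex \<Rightarrow> bool" where
  "has_complex_gradient f d p \<longleftrightarrow>
     (f has_derivative (\<lambda>h. fst d * fst h + snd d * snd h)) (at p)"

definition holomorphic2_on ::
    "(complex \<times> complex \<Rightarrow> complex) \<Rightarrow> (complex \<times> complex) set \<Rightarrow> bool" where
  "holomorphic2_on f W \<longleftrightarrow> (\<forall>p\<in>W. \<exists>d. has_complex_gradient f d p)"

text \<open>The point \<open>p\<close> ranges over the whole plane and not only over \<open>S\<close>, so that analytic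
  subsets are closed.\<close>

definition analytic_subset2 :: "(complex \<times> complex) set \<Rightarrow> bool" where
  "analytic_subset2 S \<longleftrightarrow>
     (\<forall>p. \<exists>W F. open W \<and> p \<in> W \<and> finite F \<and> (\<forall>f\<in>F. holomorphic2_on f W) \<and>
            S \<inter> W = {q \<in> W. \<forall>f\<in>F. f q = 0})"

text \<open>\<open>S\<close> is a one-dimensional complex submanifold near \<open>p\<close>.\<close>

definition regular_curve_point :: "(complex \<times> complex) set \<Rightarrow> complex \<times> complex \<Rightarrow> bool" where
  "regular_curve_point S p \<longleftrightarrow> p \<in> S \<and>
     (\<exists>W f d. open W \<and> p \<in> W \<and> holomorphic2_on f W \<and>
            has_complex_gradient f d p \<and> d \<noteq> (0, 0) \<and>
            S \<inter> W = {q \<in> W. f q = 0})"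

text \<open>Pure dimension one: the points near which \<open>S\<close> is a one-dimensional submanifold are dense
  in \<open>S\<close>. The empty set is included, since a curve in a surface may miss a chart. Singular and
  reducible sets are allowed.\<close>

definition pure_curve2 :: "(complex \<times> complex) set \<Rightarrow> bool" where
  "pure_curve2 S \<longleftrightarrow> analytic_subset2 S \<and> S \<subseteq> closure {p. regular_curve_point S p}"


section \<open>The deformed surface\<close>

text \<open>The parameters are the values \<open>t 1, \<dots>, t (k - 1)\<close>; the other values of \<open>t\<close> are never
  used. The left summand is the chart with coordinates \<open>(z, u)\<close>, the right summand the chart
  with coordinates \<open>(\<xi>, v)\<close>.\<close>

definition transition :: "nat \<Rightarrow> (nat \<Rightarrow> complex) \<Rightarrow> complex \<times> complex \<Rightarrow> complex \<times> complex" where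
  "transition k t = (\<lambda>(z, u). (inverse z, z ^ k * u + (\<Sum>i = 1..k - 1. t i * z ^ i)))"

definition gluing ::
    "nat \<Rightarrow> (nat \<Rightarrow> complex) \<Rightarrow>
     (complex \<times> complex + complex \<times> complex) rel" where
  "gluing k t =
     Id \<union> {(Inl p, Inr (transition k t p)) | p. fst p \<noteq> 0}
        \<union> {(Inr (transition k t p), Inl p) | p. fst p \<noteq> 0}"

type_synonym glued_point = "(complex \<times> complex + complex \<times> complex) set"

definition chart_U :: "nat \<Rightarrow> (nat \<Rightarrow> complex) \<Rightarrow> complex \<times> complex \<Rightarrow> glued_point" where
  "chart_U k t p = gluing k t `` {Inl p}"

definition chart_V :: "nat \<Rightarrow> (nat \<Rightarrow> complex) \<Rightarrow> complex \<times> complex \<Rightarrow> glued_point" where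
  "chart_V k t p = gluing k t `` {Inr p}"

text \<open>The quotient topology on the set of gluing classes.\<close>

definition deformed_surface :: "nat \<Rightarrow> (nat \<Rightarrow> complex) \<Rightarrow> glued_point topology" where
  "deformed_surface k t =
     topology (\<lambda>W. W \<subseteq> UNIV // gluing k t \<and> open (chart_U k t -` W) \<and> open (chart_V k t -` W))"

definition nontrivial_deformation :: "nat \<Rightarrow> (nat \<Rightarrow> complex) \<Rightarrow> bool" where
  "nontrivial_deformation k t \<longleftrightarrow> (\<exists>i\<in>{1..k - 1}. t i \<noteq> 0)"

text \<open>Analyticity and pure dimension are local conditions and the two charts cover the surface,
  so both may be tested on the chart preimages.\<close>

definition analytic_curve_in :: "nat \<Rightarrow> (nat \<Rightarrow> complex) \<Rightarrow> glued_point set \<Rightarrow> bool" where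
  "analytic_curve_in k t C \<longleftrightarrow>
     C \<noteq> {} \<and> C \<subseteq> topspace (deformed_surface k t) \<and>
     pure_curve2 (chart_U k t -` C) \<and> pure_curve2 (chart_V k t -` C)"


section \<open>The gluing is well defined\<close>

lemma transition_inj:
  assumes "fst p \<noteq> 0" "fst q \<noteq> 0" "transition k t p = transition k t q"
  shows "p = q"
  using assms by (cases p; cases q) (auto simp: transition_def)

lemma equiv_gluing: "equiv UNIV (gluing k t)"
proof (rule equivI)
  show "gluing k t \<subseteq> UNIV \<times> UNIV" by simp
  show "refl (gluing k t)" by (auto simp: refl_on_def gluing_def)
  show "sym (gluing k t)" by (auto simp: sym_def gluing_def)
  show "trans (gluing k t)"
    unfolding trans_def gluing_def
    by (auto simp del: split_paired_Ex split_paired_All dest: transition_inj)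
qed

lemma openin_deformed_surface:
  "openin (deformed_surface k t) W \<longleftrightarrow>
     W \<subseteq> UNIV // gluing k t \<and> open (chart_U k t -` W) \<and> open (chart_V k t -` W)"
proof -
  have "istopology (\<lambda>W. W \<subseteq> UNIV // gluing k t \<and>
          open (chart_U k t -` W) \<and> open (chart_V k t -` W))"
    unfolding istopology_def by (auto simp: vimage_Union intro!: open_Int open_UN)
  then show ?thesis
    unfolding deformed_surface_def by (simp add: topology_inverse')
qed

lemma topspace_deformed_surface:
  "topspace (deformed_surface k t) = UNIV // gluing k t"
proof -
  have "chart_U k t -` (UNIV // gluing k t) = UNIV" "chart_V k t -` (UNIV // gluing k t) = UNIV"
    by (auto simp: chart_U_def chart_V_def quotientI)
  then have "openin (deformed_surface k t) (UNIV // gluing k t)"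
    by (simp add: openin_deformed_surface)
  then show ?thesis
    by (metis openin_deformed_surface openin_subset openin_topspace subset_antisym)
qed

lemma deformed_surface_charts_cover:
  "topspace (deformed_surface k t) = range (chart_U k t) \<union> range (chart_V k t)"
proof -
  have "x \<in> range (chart_U k t) \<union> range (chart_V k t)" if "x \<in> UNIV // gluing k t" for x
  proof -
    from that obtain a where "x = gluing k t `` {a}" by (auto elim: quotientE)
    then show ?thesis by (cases a) (auto simp: chart_U_def chart_V_def)
  qed
  then show ?thesis
    unfolding topspace_deformed_surface
    by (auto simp: chart_U_def chart_V_def quotientI)
qed

lemma chart_eq_iff:
  "chart_U k t p = chart_V k t q \<longleftrightarrow> fst p \<noteq> 0 \<and> q = transition k t p"
  "chart_U k t p = chart_U k t p' \<longleftrightarrow> p = p'"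
  "chart_V k t q = chart_V k t q' \<longleftrightarrow> q = q'"
  unfolding chart_U_def chart_V_def
  by (auto simp: eq_equiv_class_iff[OF equiv_gluing] gluing_def simp del: split_paired_Ex
      intro: transition_inj)

end

theory Submission
  imports Defs "HOL-Complex_Analysis.Complex_Analysis"
begin

text \<open>A nontrivial deformation carries enough global holomorphic functions to embed it in an affine
  space, and a compact analytic set of positive dimension in an affine space would violate the
  maximum principle.

  Write \<open>a\<^sub>0 = 0\<close> and \<open>a\<^sub>i = t\<^sub>i\<close> for \<open>0 < i < k\<close>. The functions \<open>x\<^sub>0 = v\<close> and
  \<open>x\<^sub>m\<^sub>+\<^sub>1 = \<xi> (x\<^sub>m - a\<^sub>m)\<close> are polynomials in \<open>(\<xi>, v)\<close>. On the overlap the recursion reads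
  \<open>x\<^sub>m = z x\<^sub>m\<^sub>+\<^sub>1 + a\<^sub>m\<close>, and it ends at \<open>x\<^sub>k = u\<close>, so \<open>x\<^sub>0, \<dots>, x\<^sub>k\<close> are polynomials in
  \<open>(z, u)\<close> as well (lemma \<open>coord_V_transition\<close>). Two points of one chart with the same values of
  all \<open>x\<^sub>m\<close> but different first coordinates would force every \<open>a\<^sub>i\<close> to vanish, so a nontrivial
  deformation is embedded on each chart (lemmas \<open>coord_U_inj\<close>, \<open>coord_V_inj\<close>).

  Let \<open>C\<close> be a compact curve and \<open>p\<close> a point of \<open>C\<close> at which \<open>\<Sum> \<bar>x\<^sub>m\<bar>\<^sup>2\<close> is maximal. In a chart
  around \<open>p\<close> the function \<open>\<phi> = exp (\<Sum> x\<^sub>m cnj (x\<^sub>m p))\<close> has modulus strictly smaller than at \<open>p\<close>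
  at every other point of the curve (lemma \<open>pure_curve_no_max_of_embedding\<close>).

  What remains is the local fact that a plane analytic curve \<open>S\<close> admits no such strict peak, even
  at a singular point (theorem \<open>pure_curve_no_strict_peak\<close>). If \<open>S\<close> contains a vertical disc
  around \<open>p\<close>, this is the maximum principle in one variable. Otherwise some local equation \<open>f\<close> of
  \<open>S\<close> does not vanish identically near \<open>p\<close> on the vertical line through \<open>p\<close>, and differentiating \<open>f\<close> often enough in
  the vertical direction gives \<open>g\<close> that vanishes on \<open>S\<close> near \<open>p\<close>, while \<open>b = \<partial>g/\<partial>u\<close> does not
  vanish identically on \<open>S\<close> near \<open>p\<close>. Where \<open>b \<noteq> 0\<close>, the set \<open>{g = 0}\<close> is the graph of a
  holomorphic function of \<open>z\<close>. As \<open>S\<close> has no isolated points, it contains this graph locally. For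
  large \<open>n\<close> the maximum of \<open>\<bar>\<phi>\<^sup>n b\<bar>\<close> over \<open>S\<close> in a small ball is positive and is not attained on
  the boundary sphere, so it is attained only where \<open>S\<close> is a graph, and there \<open>\<phi>\<^sup>n b\<close> is locally
  constant along the graph. Moving along a graph therefore stays in the set of maximum points and
  increases \<open>Re z\<close>, which is impossible at the maximum point with the largest \<open>Re z\<close>.
  The factor \<open>b\<close> thus keeps the argument away from the singular points of \<open>S\<close>.\<close>

section \<open>Partial derivatives of holomorphic functions of two variables\<close>

definition partial_fst :: "(complex \<times> complex \<Rightarrow> complex) \<Rightarrow> complex \<times> complex \<Rightarrow> complex" where
  "partial_fst f p = deriv (\<lambda>w. f (w, snd p)) (fst p)"

definition partial_snd :: "(complex \<times> complex \<Rightarrow> complex) \<Rightarrow> complex \<times> complex \<Rightarrow> complex" where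
  "partial_snd f p = deriv (\<lambda>w. f (fst p, w)) (snd p)"

text \<open>Closure under partial derivatives is easier to establish for this condition than for
  complex differentiability; by Osgood's lemma the two agree on open sets.\<close>
definition separately_holomorphic_on ::
    "(complex \<times> complex \<Rightarrow> complex) \<Rightarrow> (complex \<times> complex) set \<Rightarrow> bool" where
  "separately_holomorphic_on f W \<longleftrightarrow> continuous_on W f \<and>
     (\<forall>p\<in>W. (\<lambda>w. f (w, snd p)) field_differentiable at (fst p) \<and>
            (\<lambda>w. f (fst p, w)) field_differentiable at (snd p))"

lemma open_contains_bidisc:
  fixes W :: "(complex \<times> complex) set"
  assumes "open W" "(z, u) \<in> W"
  obtains r where "r > 0" "cball z r \<times> cball u r \<subseteq> W"
proof -
  obtain A B where AB: "open A" "open B" "z \<in> A" "u \<in> B" "A \<times> B \<subseteq> W"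
    using assms by (metis mem_Sigma_iff open_prod_elim)
  obtain r s where "r > 0" "cball z r \<subseteq> A" "s > 0" "cball u s \<subseteq> B"
    using AB by (meson open_contains_cball)
  then have "min r s > 0" "cball z (min r s) \<times> cball u (min r s) \<subseteq> W"
    using AB(5) by fastforce+
  then show ?thesis using that by blast
qed

lemma separately_holomorphic_swap:
  assumes "separately_holomorphic_on f W"
  shows "separately_holomorphic_on (f \<circ> prod.swap) (prod.swap -` W)"
proof -
  have "continuous_on (prod.swap -` W) (\<lambda>p. f (prod.swap p))"
    using assms unfolding separately_holomorphic_on_def
    by (auto intro: continuous_on_compose2[OF _ continuous_on_swap])
  then show ?thesis
    using assms unfolding separately_holomorphic_on_def by (auto simp: o_def)
qed

lemma partial_snd_swap: "partial_snd (f \<circ> prod.swap) (prod.swap p) = partial_fst f p"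
  by (simp add: partial_snd_def partial_fst_def)

text \<open>Cauchy's formula for the derivative, with the contour integral written out over the unit
  interval, so that continuity and differentiation under the integral sign apply in the
  remaining variable.\<close>
lemma partial_snd_eq_integral:
  assumes sep: "separately_holomorphic_on f W" and sub: "cball z0 r \<times> cball u0 r \<subseteq> W"
    and z: "z \<in> cball z0 r" and u: "u \<in> ball u0 r"
  shows "partial_snd f (z, u) = integral (cbox 0 1)
    (\<lambda>t. f (z, circlepath u0 r t) * (circlepath 0 r t / (circlepath u0 r t - u)\<^sup>2))"
proof -
  have cont: "continuous_on (cball u0 r) (\<lambda>w. f (z, w))"
  proof (rule continuous_on_compose2[of W f])
    show "continuous_on W f" using sep by (simp add: separately_holomorphic_on_def)
  qed (use sub z in \<open>auto intro!: continuous_intros\<close>)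
  have hol: "(\<lambda>w. f (z, w)) holomorphic_on ball u0 r"
    unfolding holomorphic_on_def
  proof
    fix w assume "w \<in> ball u0 r"
    then have "(z, w) \<in> W" using sub z by auto
    then show "(\<lambda>w. f (z, w)) field_differentiable at w within ball u0 r"
      using sep field_differentiable_at_within unfolding separately_holomorphic_on_def by fastforce
  qed
  have vd: "vector_derivative (circlepath u0 r) (at t) = (2 * of_real pi * \<i>) * circlepath 0 r t" for t
    by (simp add: vector_derivative_circlepath) (simp add: circlepath)
  have "2 * of_real pi * \<i> * deriv (\<lambda>w. f (z, w)) u
      = contour_integral (circlepath u0 r) (\<lambda>w. f (z, w) / (w - u)\<^sup>2)"
    using Cauchy_contour_integral_circlepath_2[OF cont hol u] by simp
  also have "\<dots> = integral (cbox 0 1) (\<lambda>t. (2 * of_real pi * \<i>) *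
      (f (z, circlepath u0 r t) * (circlepath 0 r t / (circlepath u0 r t - u)\<^sup>2)))"
    unfolding contour_integral_integral vd by (simp add: mult_ac)
  also have "\<dots> = (2 * of_real pi * \<i>) * integral (cbox 0 1) (\<lambda>t.
      (f (z, circlepath u0 r t) * (circlepath 0 r t / (circlepath u0 r t - u)\<^sup>2)))"
    by (rule integral_mult_right)
  finally show ?thesis by (simp add: partial_snd_def)
qed

lemma continuous_on_partial_snd:
  assumes W: "open W" and sep: "separately_holomorphic_on f W"
  shows "continuous_on W (partial_snd f)"
  unfolding continuous_on_eq_continuous_at[OF W]
proof
  fix p assume p: "p \<in> W"
  obtain z0 u0 where p_eq: "p = (z0, u0)" by (cases p)
  obtain r where r: "r > 0" "cball z0 r \<times> cball u0 r \<subseteq> W"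
    using open_contains_bidisc W p unfolding p_eq by blast
  let ?B = "ball z0 r \<times> ball u0 r"
  let ?K = "\<lambda>q t. f (fst q, circlepath u0 r t) * (circlepath 0 r t / (circlepath u0 r t - snd q)\<^sup>2)"
  have sphere: "circlepath u0 r t \<in> sphere u0 r" for t
    using r(1) by (simp add: circlepath dist_norm norm_mult)
  have cpath: "continuous_on A (\<lambda>x. circlepath w r (snd x))" for A w
    unfolding circlepath by (intro continuous_intros)
  have "continuous_on (?B \<times> cbox 0 1) (\<lambda>(q, t). ?K q t)"
    unfolding split_beta
  proof (intro continuous_intros cpath)
    show "continuous_on (?B \<times> cbox 0 1) (\<lambda>x. f (fst (fst x), circlepath u0 r (snd x)))"
    proof (rule continuous_on_compose2[of W f])
      show "continuous_on W f" using sep by (simp add: separately_holomorphic_on_def)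
      show "(\<lambda>x. (fst (fst x), circlepath u0 r (snd x))) ` (?B \<times> cbox 0 1) \<subseteq> W"
        using r sphere by (force simp: sphere_def)
    qed (intro continuous_intros cpath)
    show "\<forall>x\<in>?B \<times> cbox 0 1. (circlepath u0 r (snd x) - snd (fst x))\<^sup>2 \<noteq> 0"
    proof
      fix x assume "x \<in> ?B \<times> cbox (0::real) 1"
      then have "dist u0 (snd (fst x)) < r" by auto
      moreover have "dist u0 (circlepath u0 r (snd x)) = r" using sphere[of "snd x"] by simp
      ultimately show "(circlepath u0 r (snd x) - snd (fst x))\<^sup>2 \<noteq> 0" by auto
    qed
  qed
  then have "continuous_on ?B (\<lambda>q. integral (cbox 0 1) (?K q))"
    by (rule integral_continuous_on_param)
  moreover have "partial_snd f q = integral (cbox 0 1) (?K q)" if "q \<in> ?B" for q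
    using partial_snd_eq_integral[OF sep r(2), of "fst q" "snd q"] that by auto
  ultimately have "continuous_on ?B (partial_snd f)"
    using continuous_on_cong by (metis (no_types, lifting))
  moreover have "open ?B" "p \<in> ?B" using r by (auto intro: open_Times simp: p_eq)
  ultimately show "isCont (partial_snd f) p"
    by (metis continuous_on_eq_continuous_at)
qed

lemma continuous_on_partial_fst:
  assumes W: "open W" and sep: "separately_holomorphic_on f W"
  shows "continuous_on W (partial_fst f)"
proof -
  have "open (prod.swap -` W)"
    using W by (intro open_vimage continuous_on_swap)
  then have "continuous_on (prod.swap -` W) (partial_snd (f \<circ> prod.swap))"
    by (rule continuous_on_partial_snd[OF _ separately_holomorphic_swap[OF sep]])
  then have "continuous_on W (\<lambda>p. partial_snd (f \<circ> prod.swap) (prod.swap p))"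
    by (rule continuous_on_compose2) (auto intro: continuous_on_swap)
  then show ?thesis by (simp only: partial_snd_swap)
qed

text \<open>In the second variable this is holomorphy of the derivative. In the first variable, Cauchy's
  formula in the second variable is differentiated under the integral sign; the integrand of the
  result is continuous because the first partial derivative is.\<close>
lemma separately_holomorphic_partial_snd:
  assumes W: "open W" and sep: "separately_holomorphic_on f W"
  shows "separately_holomorphic_on (partial_snd f) W"
  unfolding separately_holomorphic_on_def
proof (intro conjI ballI)
  show "continuous_on W (partial_snd f)" by (rule continuous_on_partial_snd[OF assms])
  fix p assume p: "p \<in> W"
  obtain z0 u0 where p_eq: "p = (z0, u0)" by (cases p)
  obtain r where r: "r > 0" "cball z0 r \<times> cball u0 r \<subseteq> W"
    using open_contains_bidisc W p unfolding p_eq by blast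
  have sphere: "dist u0 (circlepath u0 r t) = r" for t
    using r(1) by (simp add: circlepath dist_norm norm_mult)
  have inW: "(z, circlepath u0 r t) \<in> W" if "z \<in> ball z0 r" for z t
    using r(2) that sphere[of t] by (auto simp: subset_iff)
  show "(\<lambda>w. partial_snd f (fst p, w)) field_differentiable at (snd p)"
  proof -
    have "(\<lambda>w. f (z0, w)) holomorphic_on ball u0 r"
      unfolding holomorphic_on_def
    proof
      fix w assume "w \<in> ball u0 r"
      then have "(z0, w) \<in> W" using r by auto
      then show "(\<lambda>w. f (z0, w)) field_differentiable at w within ball u0 r"
        using sep field_differentiable_at_within unfolding separately_holomorphic_on_def by fastforce
    qed
    then have "deriv (\<lambda>w. f (z0, w)) holomorphic_on ball u0 r"
      by (rule holomorphic_deriv) simp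
    then show ?thesis
      using r(1) by (auto simp: p_eq partial_snd_def intro: holomorphic_on_imp_differentiable_at)
  qed
  show "(\<lambda>w. partial_snd f (w, snd p)) field_differentiable at (fst p)"
  proof -
    let ?k = "\<lambda>t. circlepath 0 r t / (circlepath u0 r t - u0)\<^sup>2"
    have cpath: "continuous_on A (\<lambda>x. circlepath w r (g x))" if "continuous_on A g"
      for A w and g :: "'b::topological_space \<Rightarrow> real"
      using that unfolding circlepath by (intro continuous_intros)
    have cont: "continuous_on W f" using sep by (simp add: separately_holomorphic_on_def)
    have ne: "circlepath u0 r t - u0 \<noteq> 0" for t
      using sphere[of t] r(1) by auto
    have "(\<lambda>z. integral (cbox 0 1) (\<lambda>t. f (z, circlepath u0 r t) * ?k t)) holomorphic_on ball z0 r"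
    proof (rule leibniz_rule_holomorphic)
      fix z and t :: real assume z: "z \<in> ball z0 r"
      have "((\<lambda>w. f (w, circlepath u0 r t)) has_field_derivative
          partial_fst f (z, circlepath u0 r t)) (at z)"
        using sep inW[OF z, of t] unfolding separately_holomorphic_on_def partial_fst_def
        by (fastforce simp: field_differentiable_derivI)
      then show "((\<lambda>w. f (w, circlepath u0 r t) * ?k t) has_field_derivative
          partial_fst f (z, circlepath u0 r t) * ?k t) (at z within ball z0 r)"
        by (intro DERIV_cmult_right) (rule has_field_derivative_at_within)
    next
      fix z assume z: "z \<in> ball z0 r"
      have "continuous_on (cbox 0 1) (\<lambda>t. f (z, circlepath u0 r t) * ?k t)"
        using inW[OF z] ne
        by (intro continuous_intros cpath continuous_on_compose2[OF cont]) auto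
      then show "(\<lambda>t. f (z, circlepath u0 r t) * ?k t) integrable_on cbox 0 1"
        by (rule integrable_continuous)
    next
      show "continuous_on (ball z0 r \<times> cbox 0 1)
          (\<lambda>(z, t). partial_fst f (z, circlepath u0 r t) * ?k t)"
        unfolding split_beta using inW ne
        by (intro continuous_intros cpath continuous_on_compose2[OF continuous_on_partial_fst[OF assms]])
          auto
    qed simp
    then have "(\<lambda>z. partial_snd f (z, u0)) holomorphic_on ball z0 r"
      using r(1) partial_snd_eq_integral[OF sep r(2), of _ u0]
      by (subst holomorphic_cong[OF refl]) auto
    then show ?thesis using r(1) by (auto simp: p_eq intro: holomorphic_on_imp_differentiable_at)
  qed
qed

lemma has_complex_gradient_partials:
  assumes "has_complex_gradient f d (z, u)"
  shows "((\<lambda>w. f (w, u)) has_field_derivative fst d) (at z)"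
    "((\<lambda>w. f (z, w)) has_field_derivative snd d) (at u)"
proof -
  have D: "(f has_derivative (\<lambda>h. fst d * fst h + snd d * snd h)) (at (z, u))"
    using assms by (simp add: has_complex_gradient_def)
  have "((\<lambda>w. (w, u)) has_derivative (\<lambda>h. (h, 0))) (at z)"
    "((\<lambda>w. (z, w)) has_derivative (\<lambda>h. (0, h))) (at u)"
    by (auto intro!: derivative_eq_intros)
  from has_derivative_compose[OF this(1) D] has_derivative_compose[OF this(2) D]
  show "((\<lambda>w. f (w, u)) has_field_derivative fst d) (at z)"
    "((\<lambda>w. f (z, w)) has_field_derivative snd d) (at u)"
    by (simp_all add: has_field_derivative_def)
qed

lemma has_complex_gradient_unique:
  assumes "has_complex_gradient f d p"
  shows "d = (partial_fst f p, partial_snd f p)"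
  using has_complex_gradient_partials[of f d "fst p" "snd p"] assms
  by (simp add: partial_fst_def partial_snd_def prod_eq_iff DERIV_imp_deriv)

lemma holomorphic2_imp_separately:
  assumes "holomorphic2_on f W"
  shows "separately_holomorphic_on f W"
  unfolding separately_holomorphic_on_def
proof (intro conjI ballI)
  show "continuous_on W f"
    using assms unfolding holomorphic2_on_def has_complex_gradient_def
    by (meson continuous_at_imp_continuous_on has_derivative_continuous)
  fix p assume "p \<in> W"
  then obtain d where "has_complex_gradient f d (fst p, snd p)"
    using assms by (auto simp: holomorphic2_on_def)
  from has_complex_gradient_partials[OF this]
  show "(\<lambda>w. f (w, snd p)) field_differentiable at (fst p)"
    "(\<lambda>w. f (fst p, w)) field_differentiable at (snd p)"
    by (auto simp: field_differentiable_def)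
qed

text \<open>Osgood's lemma: the partial derivatives are continuous, so the function is totally
  differentiable.\<close>
lemma separately_imp_holomorphic2:
  assumes W: "open W" and sep: "separately_holomorphic_on f W"
  shows "holomorphic2_on f W"
  unfolding holomorphic2_on_def
proof
  fix p assume p: "p \<in> W"
  obtain z0 u0 where p_eq: "p = (z0, u0)" by (cases p)
  obtain r where r: "r > 0" "cball z0 r \<times> cball u0 r \<subseteq> W"
    using open_contains_bidisc W p unfolding p_eq by blast
  let ?X = "ball z0 r" and ?Y = "ball u0 r"
  have XY: "?X \<times> ?Y \<subseteq> W" using r by force
  have "((\<lambda>(x, y). f (x, y)) has_derivative
      (\<lambda>(tx, ty). partial_fst f p * tx + blinfun_mult_right (partial_snd f (z0, u0)) ty))
      (at (z0, u0) within ?X \<times> ?Y)"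
  proof (rule has_derivative_partialsI[where fy = "\<lambda>x y. blinfun_mult_right (partial_snd f (x, y))"])
    have "((\<lambda>x. f (x, u0)) has_field_derivative partial_fst f p) (at z0)"
      using sep p unfolding separately_holomorphic_on_def p_eq partial_fst_def
      by (fastforce simp: field_differentiable_derivI)
    then show "((\<lambda>x. f (x, u0)) has_derivative (*) (partial_fst f p)) (at z0 within ?X)"
      by (simp add: has_field_derivative_def has_derivative_at_withinI)
  next
    fix x y assume "x \<in> ?X" "y \<in> ?Y"
    then have "(x, y) \<in> W" using XY by auto
    then have "((\<lambda>y. f (x, y)) has_field_derivative partial_snd f (x, y)) (at y)"
      using sep unfolding separately_holomorphic_on_def partial_snd_def
      by (fastforce simp: field_differentiable_derivI)
    then show "((\<lambda>y. f (x, y)) has_derivative blinfun_mult_right (partial_snd f (x, y)))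
        (at y within ?Y)"
      by (simp add: has_field_derivative_def has_derivative_at_withinI)
  next
    have "continuous_on (?X \<times> ?Y) (\<lambda>q. blinfun_mult_right (partial_snd f q))"
      using continuous_on_partial_snd[OF assms] XY continuous_on_subset
      by (intro bounded_linear.continuous_on[OF bounded_linear_blinfun_mult_right]) blast
    then show "continuous (at (z0, u0) within ?X \<times> ?Y)
        (\<lambda>(x, y). blinfun_mult_right (partial_snd f (x, y)))"
      using r(1) by (simp add: continuous_on_eq_continuous_within case_prod_unfold)
  qed (use r in auto)
  moreover have "at (z0, u0) within ?X \<times> ?Y = at (z0, u0)"
    using r(1) by (intro at_within_open open_Times) auto
  ultimately have "has_complex_gradient f (partial_fst f p, partial_snd f p) p"
    by (simp add: has_complex_gradient_def case_prod_unfold p_eq)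
  then show "\<exists>d. has_complex_gradient f d p" ..
qed

lemma holomorphic2_partial_snd:
  assumes "open W" "holomorphic2_on f W"
  shows "holomorphic2_on (partial_snd f) W"
  using assms separately_imp_holomorphic2 separately_holomorphic_partial_snd
    holomorphic2_imp_separately by blast

lemma holomorphic2_subset: "holomorphic2_on f W \<Longrightarrow> W' \<subseteq> W \<Longrightarrow> holomorphic2_on f W'"
  by (auto simp: holomorphic2_on_def)

lemma holomorphic2_gradient:
  assumes "holomorphic2_on f W" "p \<in> W"
  shows "has_complex_gradient f (partial_fst f p, partial_snd f p) p"
  using assms has_complex_gradient_unique unfolding holomorphic2_on_def by metis

lemma holomorphic2_on_graph:
  assumes f: "holomorphic2_on f W" and h: "h holomorphic_on A" and A: "open A"
    and sub: "\<And>z. z \<in> A \<Longrightarrow> (z, h z) \<in> W"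
  shows "(\<lambda>z. f (z, h z)) holomorphic_on A"
  unfolding holomorphic_on_open[OF A]
proof
  fix z assume z: "z \<in> A"
  let ?d = "(partial_fst f (z, h z), partial_snd f (z, h z))"
  have "(h has_derivative (*) (deriv h z)) (at z)"
    using holomorphic_derivI[OF h A z] by (simp add: has_field_derivative_def)
  then have "((\<lambda>z. (z, h z)) has_derivative (\<lambda>k. (k, deriv h z * k))) (at z)"
    by (auto intro!: derivative_eq_intros)
  from has_derivative_compose[OF this
      holomorphic2_gradient[OF f sub[OF z], unfolded has_complex_gradient_def]]
  have "((\<lambda>z. f (z, h z)) has_field_derivative (fst ?d + snd ?d * deriv h z)) (at z)"
    unfolding has_field_derivative_def
    by (rule has_derivative_eq_rhs) (simp add: fun_eq_iff algebra_simps)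
  then show "\<exists>f'. ((\<lambda>z. f (z, h z)) has_field_derivative f') (at z)" ..
qed

section \<open>Local graphs inside a curve\<close>

text \<open>The holomorphic implicit function theorem. The map \<open>(z, u) \<mapsto> (z, g (z, u))\<close> is locally
  invertible, and its inverse sends \<open>(z, 0)\<close> to the point of the graph over \<open>z\<close>; the derivative of the inverse is
  complex linear, so the graph is holomorphic.\<close>
lemma implicit_graph:
  assumes W: "open W" and g: "holomorphic2_on g W" and p: "(z1, u1) \<in> W"
    and g0: "g (z1, u1) = 0" and gu: "partial_snd g (z1, u1) \<noteq> 0"
  obtains h r N where "r > 0" "h holomorphic_on ball z1 r" "h z1 = u1"
    "open N" "(z1, u1) \<in> N" "N \<subseteq> W"
    "\<And>z. z \<in> ball z1 r \<Longrightarrow> (z, h z) \<in> N \<and> g (z, h z) = 0"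
    "\<And>z u. (z, u) \<in> N \<Longrightarrow> z \<in> ball z1 r \<Longrightarrow> g (z, u) = 0 \<Longrightarrow> u = h z"
proof -
  have sep: "separately_holomorphic_on g W" using g by (rule holomorphic2_imp_separately)
  note conts = continuous_on_partial_fst[OF W sep] continuous_on_partial_snd[OF W sep]
  define U where "U = {p \<in> W. partial_snd g p \<noteq> 0}"
  have "U = W \<inter> partial_snd g -` (- {0})" by (auto simp: U_def)
  then have U: "open U" using continuous_open_preimage[OF conts(2) W, of "- {0}"]
    by (simp add: open_Compl)
  have UW: "U \<subseteq> W" by (auto simp: U_def)
  define F where "F p = (fst p, g p)" for p
  define L where "L p k = (fst k, partial_fst g p * fst k + partial_snd g p * snd k)"
    for p k :: "complex \<times> complex"
  have lin: "bounded_linear (L p)" for p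
    unfolding L_def
    by (intro bounded_linear_Pair bounded_linear_fst bounded_linear_add
        bounded_linear_const_mult bounded_linear_snd)
  then have ap: "blinfun_apply (Blinfun (L p)) = L p" for p by (rule bounded_linear_Blinfun_apply)
  have derF: "(F has_derivative L p) (at p)" if "p \<in> U" for p
  proof -
    have "(g has_derivative (\<lambda>h. partial_fst g p * fst h + partial_snd g p * snd h)) (at p)"
      using holomorphic2_gradient[OF g, of p] that UW by (auto simp: has_complex_gradient_def)
    then show ?thesis
      unfolding F_def L_def by (intro has_derivative_Pair bounded_linear_imp_has_derivative bounded_linear_fst)
  qed
  \<comment> \<open>The inverse of \<open>L p\<close> where the vertical derivative is nonzero.\<close>
  define M where "M p k = (fst k, (snd k - partial_fst g p * fst k) / partial_snd g p)"
    for p k :: "complex \<times> complex"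
  have linM: "bounded_linear (M p)" for p
    unfolding M_def
    by (intro bounded_linear_Pair bounded_linear_fst bounded_linear_sub bounded_linear_divide[THEN bounded_linear_compose]
        bounded_linear_const_mult bounded_linear_snd)
  have LM: "L p \<circ> M p = id" "M p \<circ> L p = id" if "p \<in> U" for p
    using that by (auto simp: L_def M_def U_def field_simps)
  obtain U' V G G' where G: "open U'" "U' \<subseteq> U" "(z1, u1) \<in> U'" "open V" "F (z1, u1) \<in> V"
    "homeomorphism U' V F G"
  proof (rule inverse_function_theorem[OF U, of F "\<lambda>p. Blinfun (L p)" "(z1, u1)" "Blinfun (M (z1, u1))"])
    show "continuous_on U (\<lambda>p. Blinfun (L p))"
    proof (rule continuous_on_blinfun_componentwise)
      fix i :: "complex \<times> complex"
      show "continuous_on U (\<lambda>p. blinfun_apply (Blinfun (L p)) i)"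
        unfolding ap L_def using conts UW continuous_on_subset by (intro continuous_intros) blast+
    qed
    show p1: "(z1, u1) \<in> U" using p gu by (simp add: U_def)
    show "Blinfun (M (z1, u1)) o\<^sub>L Blinfun (L (z1, u1)) = id_blinfun"
      using fun_cong[OF LM(2)[OF p1]] by (intro blinfun_eqI)
        (simp add: ap bounded_linear_Blinfun_apply[OF linM] del: split_paired_All)
  qed (use derF ap in auto)
  have Fp: "F (z1, u1) = (z1, 0)" using g0 by (simp add: F_def)
  have "(z1, 0) \<in> V" using G(5) Fp by simp
  then obtain r where r: "r > 0" "cball z1 r \<times> cball 0 r \<subseteq> V"
    using open_contains_bidisc[OF G(4)] by metis
  have inV: "(z, 0) \<in> V" if "z \<in> ball z1 r" for z
    using r that by (auto simp: subset_iff)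
  have FG: "F (G y) = y" "G y \<in> U'" if "y \<in> V" for y
    using G(6) that by (auto simp: homeomorphism_def)
  have GF: "G (F x) = x" if "x \<in> U'" for x
    using G(6) that by (auto simp: homeomorphism_def)
  define h where "h z = snd (G (z, 0))" for z
  have Gh: "G (z, 0) = (z, h z)" "g (z, h z) = 0" if "z \<in> ball z1 r" for z
  proof -
    have "F (G (z, 0)) = (z, 0)" using FG inV that by blast
    then show "G (z, 0) = (z, h z)" "g (z, h z) = 0"
      by (auto simp: F_def h_def prod_eq_iff) (metis prod.collapse)
  qed
  have "h holomorphic_on ball z1 r"
    unfolding holomorphic_on_open[OF open_ball]
  proof
    fix z assume z: "z \<in> ball z1 r"
    let ?p = "G (z, 0)"
    have pU: "?p \<in> U" using FG inV[OF z] G(2) by blast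
    have "(G has_derivative M ?p) (at (z, 0))"
    proof (rule has_derivative_inverse_strong_x[OF G(1), of G _ F "L ?p"])
      show "continuous_on U' F" using G(6) by (simp add: homeomorphism_def)
    qed (use FG inV[OF z] GF derF[OF pU] LM[OF pU] in auto)
    moreover have "((\<lambda>z. (z, 0::complex)) has_derivative (\<lambda>k. (k, 0))) (at z)"
      by (auto intro!: derivative_eq_intros)
    ultimately have "((\<lambda>z. G (z, 0)) has_derivative (\<lambda>k. M ?p (k, 0))) (at z)"
      by (rule has_derivative_compose[rotated])
    from has_derivative_snd[OF this]
    have "(h has_field_derivative (- partial_fst g ?p / partial_snd g ?p)) (at z)"
      unfolding has_field_derivative_def h_def
      by (rule has_derivative_eq_rhs) (simp add: M_def fun_eq_iff)
    then show "\<exists>h'. (h has_field_derivative h') (at z)" ..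
  qed
  moreover have "h z1 = u1" using GF[OF G(3)] Fp by (simp add: h_def)
  moreover have "(z, h z) \<in> U' \<and> g (z, h z) = 0" if "z \<in> ball z1 r" for z
    using Gh[OF that] FG inV[OF that] by metis
  moreover have "u = h z" if "(z, u) \<in> U'" "z \<in> ball z1 r" "g (z, u) = 0" for z u
    using GF[OF that(1)] that(3) by (simp add: F_def h_def)
  ultimately show ?thesis
    using that[of r h U'] r(1) G(1-3) UW by blast
qed

text \<open>The case where the implicit function theorem solves for the second coordinate; the
  remaining case follows by exchanging the coordinates.\<close>
lemma regular_zero_not_isolated_aux:
  assumes W: "open W" and f: "holomorphic2_on f W" and p: "p \<in> W" and f0: "f p = 0"
    and fu: "partial_snd f p \<noteq> 0" and N: "open N" "p \<in> N"
  shows "\<exists>q\<in>W \<inter> N. q \<noteq> p \<and> f q = 0"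
proof -
  obtain z1 u1 where p_eq: "p = (z1, u1)" by (cases p)
  have *: "open (W \<inter> N)" "holomorphic2_on f (W \<inter> N)" "(z1, u1) \<in> W \<inter> N"
    using W N p f holomorphic2_subset p_eq by auto
  obtain h r N' where h: "r > 0" "N' \<subseteq> W \<inter> N"
    "\<And>z. z \<in> ball z1 r \<Longrightarrow> (z, h z) \<in> N' \<and> f (z, h z) = 0"
    using implicit_graph[OF * f0[unfolded p_eq] fu[unfolded p_eq]] by metis
  let ?z = "z1 + of_real (r / 2)"
  have "?z \<in> ball z1 r" "?z \<noteq> z1" using h(1) by (auto simp: dist_norm)
  then show ?thesis using h(2,3) p_eq by blast
qed

lemma regular_zero_not_isolated:
  assumes W: "open W" and f: "holomorphic2_on f W" and p: "p \<in> W" and f0: "f p = 0"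
    and d: "has_complex_gradient f d p" "d \<noteq> (0, 0)" and N: "open N" "p \<in> N"
  shows "\<exists>q\<in>W \<inter> N. q \<noteq> p \<and> f q = 0"
proof (cases "partial_snd f p = 0")
  case False
  then show ?thesis using regular_zero_not_isolated_aux assms by blast
next
  case True
  then have fz: "partial_snd (f \<circ> prod.swap) (prod.swap p) \<noteq> 0"
    using has_complex_gradient_unique[OF d(1)] d(2) by (simp only: partial_snd_swap) auto
  have ov: "open (prod.swap -` A)" if "open A" for A :: "(complex \<times> complex) set"
    using that by (intro open_vimage continuous_on_swap)
  have "holomorphic2_on (f \<circ> prod.swap) (prod.swap -` W)"
    by (rule separately_imp_holomorphic2[OF ov[OF W]
          separately_holomorphic_swap[OF holomorphic2_imp_separately[OF f]]])
  from regular_zero_not_isolated_aux[OF ov[OF W] this _ _ fz ov[OF N(1)]]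
  have "\<exists>q\<in>prod.swap -` W \<inter> prod.swap -` N. q \<noteq> prod.swap p \<and> (f \<circ> prod.swap) q = 0"
    using p f0 N(2) by simp
  then obtain q where "prod.swap q \<in> W \<inter> N" "q \<noteq> prod.swap p" "f (prod.swap q) = 0" by auto
  then show ?thesis by (metis swap_swap)
qed

lemma pure_curve_not_isolated:
  assumes S: "pure_curve2 S" and p: "p \<in> S" and N: "open N" "p \<in> N"
  shows "\<exists>q\<in>S \<inter> N. q \<noteq> p"
proof -
  have "p \<in> closure {q. regular_curve_point S q}"
    using S p by (auto simp: pure_curve2_def)
  then obtain q where q: "regular_curve_point S q" "q \<in> N"
    using N unfolding closure_iff_nhds_not_empty by (metis disjoint_iff mem_Collect_eq subset_refl)
  show ?thesis
  proof (cases "q = p")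
    case False
    then show ?thesis using q by (auto simp: regular_curve_point_def)
  next
    case True
    obtain W f d where W: "open W" "p \<in> W" "holomorphic2_on f W"
        "has_complex_gradient f d p" "d \<noteq> (0, 0)" "S \<inter> W = {q \<in> W. f q = 0}"
      using q(1) unfolding True regular_curve_point_def by blast
    then have "f p = 0" using p by blast
    then obtain q' where "q' \<in> W \<inter> N" "q' \<noteq> p" "f q' = 0"
      using regular_zero_not_isolated[OF W(1,3,2) _ W(4,5) N] by blast
    then show ?thesis using W(6) by blast
  qed
qed

text \<open>Near \<open>q\<close> the curve lies in the graph \<open>{g = 0}\<close>. A local equation of \<open>S\<close> that did not vanish
  identically on the graph would have an isolated zero at \<open>q\<close>, which would make \<open>q\<close> isolated in
  \<open>S\<close>. So the whole graph lies in \<open>S\<close>.\<close>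
lemma graph_in_curve:
  assumes S: "pure_curve2 S" and q: "q \<in> S"
    and W: "q \<in> W" "\<forall>f\<in>F. holomorphic2_on f W"
      "S \<inter> W = {q \<in> W. \<forall>f\<in>F. f q = 0}"
    and N: "open N" "q \<in> N" "N \<subseteq> W"
    and g: "holomorphic2_on g N" "\<And>q. q \<in> S \<inter> N \<Longrightarrow> g q = 0"
      "partial_snd g q \<noteq> 0"
  obtains h r where "r > 0" "h holomorphic_on ball (fst q) r" "h (fst q) = snd q"
    "\<And>z. z \<in> ball (fst q) r \<Longrightarrow> (z, h z) \<in> S \<inter> N"
proof -
  obtain z1 u1 where q_eq: "q = (z1, u1)" by (cases q)
  have "(z1, u1) \<in> N" "g (z1, u1) = 0" "partial_snd g (z1, u1) \<noteq> 0"
    using N g q by (auto simp: q_eq)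
  from implicit_graph[OF N(1) g(1) this]
  obtain h r N' where h: "r > 0" "h holomorphic_on ball z1 r" "h z1 = u1"
    "open N'" "(z1, u1) \<in> N'" "N' \<subseteq> N"
    "\<And>z. z \<in> ball z1 r \<Longrightarrow> (z, h z) \<in> N' \<and> g (z, h z) = 0"
    "\<And>z u. (z, u) \<in> N' \<Longrightarrow> z \<in> ball z1 r \<Longrightarrow> g (z, u) = 0 \<Longrightarrow> u = h z"
    by metis
  have hW: "(z, h z) \<in> W" if "z \<in> ball z1 r" for z
    using h(6,7) N(3) that by blast
  have F0: "f (z, h z) = 0" if f: "f \<in> F" and z: "z \<in> ball z1 r" for f z
  proof (rule ccontr)
    assume nz: "f (z, h z) \<noteq> 0"
    have "(\<lambda>z. f (z, h z)) holomorphic_on ball z1 r"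
      using W(2) f h(2) hW by (intro holomorphic2_on_graph[of f W]) auto
    moreover have "f (z1, h z1) = 0" using W q f h(3) q_eq by auto
    ultimately obtain r' where r': "r' > 0" "ball z1 r' \<subseteq> ball z1 r"
        "\<And>z. z \<in> ball z1 r' - {z1} \<Longrightarrow> f (z, h z) \<noteq> 0"
      using isolated_zeros[of "\<lambda>z. f (z, h z)" "ball z1 r" z1 z] nz z h(1) by auto
    have "open (N' \<inter> (ball z1 r' \<times> UNIV))" "q \<in> N' \<inter> (ball z1 r' \<times> UNIV)"
      using h r' q_eq by (auto intro: open_Times)
    then obtain q' where q': "q' \<in> S" "q' \<in> N'" "fst q' \<in> ball z1 r'" "q' \<noteq> q"
      using pure_curve_not_isolated[OF S q] by (metis IntE mem_Times_iff)
    have "q' \<in> N" using q' h(6) by auto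
    then have "g q' = 0" "f q' = 0" using g(2) q' W(3) N(3) f by auto
    then have "snd q' = h (fst q')" using h(8)[of "fst q'" "snd q'"] q' r'(2) by auto
    moreover from this have "fst q' = z1" using r'(3)[of "fst q'"] \<open>f q' = 0\<close> q'(3)
      by (metis Diff_iff empty_iff insert_iff prod.collapse)
    ultimately show False using q'(4) h(3) q_eq by (auto simp: prod_eq_iff)
  qed
  have "(z, h z) \<in> S \<inter> N" if "z \<in> ball z1 r" for z
  proof -
    have "(z, h z) \<in> N" using h(6,7) that by blast
    moreover have "(z, h z) \<in> {q \<in> W. \<forall>f\<in>F. f q = 0}" using F0[OF _ that] hW[OF that] by blast
    ultimately show ?thesis using W(3) by blast
  qed
  then show ?thesis using that[of r h] h(1-3) q_eq by auto
qed

lemma funpow_partial_snd: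
  "(partial_snd ^^ n) f p = (deriv ^^ n) (\<lambda>w. f (fst p, w)) (snd p)"
  by (induction n arbitrary: p) (simp_all add: partial_snd_def)

lemma holomorphic2_funpow_partial_snd:
  "open W \<Longrightarrow> holomorphic2_on f W \<Longrightarrow> holomorphic2_on ((partial_snd ^^ n) f) W"
  by (induction n) (auto intro: holomorphic2_partial_snd)

lemma holomorphic2_continuous: "holomorphic2_on f W \<Longrightarrow> continuous_on W f"
  using holomorphic2_imp_separately by (auto simp: separately_holomorphic_on_def)

section \<open>The maximum principle on a plane analytic curve\<close>
lemma vertical_line_no_peak:
  assumes \<phi>: "holomorphic2_on \<phi> UNIV"
    and line: "eventually (\<lambda>u. (z0, u) \<in> S) (nhds u0)"
    and peak: "\<And>q. q \<in> S \<Longrightarrow> q \<noteq> (z0, u0) \<Longrightarrow> cmod (\<phi> q) < cmod (\<phi> (z0, u0))"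
  shows False
proof -
  obtain e where e: "e > 0" "\<And>u. u \<in> ball u0 e \<Longrightarrow> (z0, u) \<in> S"
    using line unfolding eventually_nhds_metric by (auto simp: dist_commute)
  have "(\<lambda>u. \<phi> (z0, u)) field_differentiable at u" for u
    using holomorphic2_imp_separately[OF \<phi>] unfolding separately_holomorphic_on_def by force
  then have "(\<lambda>u. \<phi> (z0, u)) holomorphic_on ball u0 e"
    by (simp add: holomorphic_on_def field_differentiable_at_within)
  moreover have "cmod (\<phi> (z0, u)) \<le> cmod (\<phi> (z0, u0))" if "u \<in> ball u0 e" for u
    using peak[OF e(2)[OF that]] by (cases "u = u0") auto
  ultimately have "(\<lambda>u. \<phi> (z0, u)) constant_on ball u0 e"
    using e(1) by (intro maximum_modulus_principle[of _ _ "ball u0 e" u0]) auto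
  moreover define u where "u = u0 + of_real (e / 2)"
  have u: "u \<in> ball u0 e" "u \<noteq> u0" using e(1) by (auto simp: u_def dist_norm)
  ultimately have "\<phi> (z0, u) = \<phi> (z0, u0)" using e(1) unfolding constant_on_def by fastforce
  then show False using peak[OF e(2)[OF u(1)]] u(2) by simp
qed

text \<open>Some vertical derivative of \<open>f\<close> is nonzero at \<open>p\<close> itself, so there is a first one that does
  not vanish on \<open>S\<close> near \<open>p\<close>. The derivative before it is \<open>g\<close>.\<close>
lemma vertical_vanishing_order:
  assumes W: "open W" "p \<in> W" and f: "holomorphic2_on f W"
    and S0: "\<And>q. q \<in> S \<inter> W \<Longrightarrow> f q = 0" and pS: "p \<in> S"
    and nv: "\<not> eventually (\<lambda>u. f (fst p, u) = 0) (nhds (snd p))"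
  obtains g N where "open N" "p \<in> N" "N \<subseteq> W" "holomorphic2_on g N"
    "\<And>q. q \<in> S \<inter> N \<Longrightarrow> g q = 0"
    "\<And>N'. open N' \<Longrightarrow> p \<in> N' \<Longrightarrow> \<exists>q\<in>S \<inter> N'. partial_snd g q \<noteq> 0"
proof -
  define D where "D n = (partial_snd ^^ n) f" for n
  define P where "P n \<longleftrightarrow> (\<exists>N. open N \<and> p \<in> N \<and> (\<forall>q\<in>S \<inter> N. D n q = 0))" for n
  have hol: "holomorphic2_on (D n) W" for n
    unfolding D_def by (rule holomorphic2_funpow_partial_snd[OF W(1) f])
  have "\<exists>n. D n p \<noteq> 0"
  proof (rule ccontr)
    assume "\<nexists>n. D n p \<noteq> 0"
    then have der: "(deriv ^^ n) (\<lambda>u. f (fst p, u)) (snd p) = 0" for n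
      by (simp add: D_def funpow_partial_snd)
    obtain r where r: "r > 0" "cball (fst p) r \<times> cball (snd p) r \<subseteq> W"
      using open_contains_bidisc[OF W(1), of "fst p" "snd p"] W(2) by auto
    have "(\<lambda>u. f (fst p, u)) holomorphic_on ball (snd p) r"
      unfolding holomorphic_on_def
    proof
      fix u assume "u \<in> ball (snd p) r"
      then have "(fst p, u) \<in> W" using r by auto
      then show "(\<lambda>u. f (fst p, u)) field_differentiable at u within ball (snd p) r"
        using holomorphic2_imp_separately[OF f] field_differentiable_at_within
        unfolding separately_holomorphic_on_def by fastforce
    qed
    then have "f (fst p, u) = 0" if "u \<in> ball (snd p) r" for u
      using holomorphic_fun_eq_0_on_connected[of "\<lambda>u. f (fst p, u)" "ball (snd p) r" "snd p" u]
        der that r(1) by auto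
    then have "eventually (\<lambda>u. f (fst p, u) = 0) (nhds (snd p))"
      unfolding eventually_nhds using r(1) by (intro exI[of _ "ball (snd p) r"]) auto
    then show False using nv by simp
  qed
  then have "\<exists>n. \<not> P n" using pS unfolding P_def by blast
  then obtain n where n: "\<not> P n" "\<And>m. m < n \<Longrightarrow> P m"
    using that[of "LEAST n. \<not> P n"] LeastI_ex[of "\<lambda>n. \<not> P n"] not_less_Least[of _ "\<lambda>n. \<not> P n"]
    by blast
  have "P 0" unfolding P_def D_def using W S0 by (intro exI[of _ W]) simp
  then obtain m where m: "n = Suc m" using n(1) by (cases n) auto
  then obtain N where N: "open N" "p \<in> N" "\<forall>q\<in>S \<inter> N. D m q = 0"
    using n(2)[of m] unfolding P_def by blast
  have "partial_snd (D m) = D n" by (simp add: D_def m)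
  then have "\<exists>q\<in>S \<inter> N'. partial_snd (D m) q \<noteq> 0" if "open N'" "p \<in> N'" for N'
    using n(1) that unfolding P_def by auto
  then show ?thesis
    using that[of "N \<inter> W" "D m"] N W holomorphic2_subset[OF hol[of m], of "N \<inter> W"] by auto
qed

text \<open>The maximum is moved to a point where the curve is a graph: multiplying a high power of \<open>\<phi>\<close>
  by the vertical derivative \<open>b\<close> of the function \<open>g\<close> found above makes the product zero at all points where the
  implicit function theorem fails, without moving the maximum to the boundary of the ball.\<close>
theorem pure_curve_no_strict_peak:
  assumes S: "pure_curve2 S" and p: "p \<in> S" and \<phi>: "holomorphic2_on \<phi> UNIV"
    and peak: "\<And>q. q \<in> S \<Longrightarrow> q \<noteq> p \<Longrightarrow> cmod (\<phi> q) < cmod (\<phi> p)"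
  shows False
proof -
  obtain W F where W: "open W" "p \<in> W" and F: "finite F" "\<forall>f\<in>F. holomorphic2_on f W"
      and SW: "S \<inter> W = {q \<in> W. \<forall>f\<in>F. f q = 0}"
    using S unfolding pure_curve2_def analytic_subset2_def by meson
  have "\<not> (\<forall>f\<in>F. eventually (\<lambda>u. f (fst p, u) = 0) (nhds (snd p)))"
  proof
    assume "\<forall>f\<in>F. eventually (\<lambda>u. f (fst p, u) = 0) (nhds (snd p))"
    then have "eventually (\<lambda>u. \<forall>f\<in>F. f (fst p, u) = 0) (nhds (snd p))"
      using F(1) by (simp add: eventually_ball_finite)
    moreover have "eventually (\<lambda>u. (fst p, u) \<in> W) (nhds (snd p))"
    proof -
      have "open (Pair (fst p) -` W)" by (intro open_vimage W(1) continuous_intros)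
      then show ?thesis using W(2) eventually_nhds_in_open[of "Pair (fst p) -` W" "snd p"] by simp
    qed
    ultimately have "eventually (\<lambda>u. (fst p, u) \<in> S) (nhds (snd p))"
      by eventually_elim (use SW in blast)
    from vertical_line_no_peak[OF \<phi> this] peak show False by simp
  qed
  then obtain f where f: "f \<in> F" "\<not> eventually (\<lambda>u. f (fst p, u) = 0) (nhds (snd p))" by blast
  obtain g N where N: "open N" "p \<in> N" "N \<subseteq> W" and g: "holomorphic2_on g N"
      "\<And>q. q \<in> S \<inter> N \<Longrightarrow> g q = 0"
    and b0: "\<And>N'. open N' \<Longrightarrow> p \<in> N' \<Longrightarrow> \<exists>q\<in>S \<inter> N'. partial_snd g q \<noteq> 0"
  proof (rule vertical_vanishing_order[OF W _ _ p f(2)])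
    show "holomorphic2_on f W" using F f(1) by blast
    show "f q = 0" if "q \<in> S \<inter> W" for q using SW f(1) that by blast
  qed (rule that)
  define b where "b = partial_snd g"
  have b: "holomorphic2_on b N" unfolding b_def by (rule holomorphic2_partial_snd[OF N(1) g(1)])
  obtain \<rho> where \<rho>: "\<rho> > 0" "cball p \<rho> \<subseteq> N" using N open_contains_cball by blast
  define X where "X = S \<inter> cball p \<rho>"
  have X: "compact X"
  proof -
    have "X = (\<Inter>f\<in>F. {q \<in> cball p \<rho>. f q = 0})"
      using f(1) SW \<rho>(2) N(3) unfolding X_def by blast
    moreover have "closed {q \<in> cball p \<rho>. f q = 0}" if "f \<in> F" for f
      using that F(2) \<rho>(2) N(3)
      by (intro continuous_closed_preimage_constant closed_cball)
        (meson continuous_on_subset holomorphic2_continuous order_trans)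
    ultimately have "closed X" by auto
    then have "compact (X \<inter> cball p \<rho>)" by (intro closed_Int_compact) auto
    then show ?thesis by (simp add: X_def)
  qed
  have c\<phi>: "continuous_on A \<phi>" for A
    using holomorphic2_continuous[OF \<phi>] continuous_on_subset by blast
  have cb: "continuous_on (cball p \<rho>) b"
    using holomorphic2_continuous[OF b] \<rho>(2) continuous_on_subset by blast
  have pos: "cmod (\<phi> p) > 0"
    using pure_curve_not_isolated[OF S p, of UNIV] peak by (smt (verit) Int_iff norm_ge_zero open_UNIV UNIV_I)
  obtain s where s: "0 \<le> s" "s < cmod (\<phi> p)" "\<And>q. q \<in> S \<inter> sphere p \<rho> \<Longrightarrow> cmod (\<phi> q) \<le> s"
  proof (cases "S \<inter> sphere p \<rho> = {}")
    case True
    then show ?thesis using that[of 0] pos by auto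
  next
    case False
    have "S \<inter> sphere p \<rho> = X \<inter> sphere p \<rho>" by (auto simp: X_def)
    then have "compact (S \<inter> sphere p \<rho>)" using X compact_Int_closed by auto
    then obtain q where q: "q \<in> S \<inter> sphere p \<rho>"
        "\<forall>q'\<in>S \<inter> sphere p \<rho>. cmod (\<phi> q') \<le> cmod (\<phi> q)"
      using continuous_attains_sup[OF _ False, of "\<lambda>q. cmod (\<phi> q)"] c\<phi> continuous_on_norm by blast
    have "q \<noteq> p" using q(1) \<rho>(1) by auto
    then show ?thesis using that[of "cmod (\<phi> q)"] q peak by auto
  qed
  have "open ({q. s < cmod (\<phi> q)} \<inter> ball p \<rho>)"
    by (intro open_Int open_Collect_less open_ball continuous_intros c\<phi>)
  moreover have "p \<in> {q. s < cmod (\<phi> q)} \<inter> ball p \<rho>" using s \<rho> by auto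
  ultimately obtain q0 where q0: "q0 \<in> S" "s < cmod (\<phi> q0)" "q0 \<in> ball p \<rho>" "b q0 \<noteq> 0"
    unfolding b_def using b0 by blast
  obtain B where B: "\<And>q. q \<in> cball p \<rho> \<Longrightarrow> cmod (b q) \<le> B"
    using compact_continuous_image[OF cb compact_cball] compact_imp_bounded bounded_iff
    by (metis imageI)
  \<comment> \<open>For large \<open>k\<close> the value of \<open>\<bar>\<phi>\<^sup>k b\<bar>\<close> at \<open>q0\<close> exceeds its values on the sphere.\<close>
  have "norm (s / cmod (\<phi> q0)) < 1"
    using s(1) q0(2) by (simp add: divide_less_eq)
  then have "(\<lambda>k. (s / cmod (\<phi> q0)) ^ k * B) \<longlonglongrightarrow> 0 * B"
    by (intro tendsto_mult LIMSEQ_power_zero tendsto_const)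
  then have "eventually (\<lambda>k. (s / cmod (\<phi> q0)) ^ k * B < cmod (b q0)) sequentially"
    using q0(4) by (intro order_tendstoD(2)[of _ 0]) auto
  then obtain k where "(s / cmod (\<phi> q0)) ^ k * B < cmod (b q0)"
    by (auto simp: eventually_sequentially)
  moreover have "0 < cmod (\<phi> q0) ^ k" using s(1) q0(2) by (intro zero_less_power) linarith
  ultimately have k: "s ^ k * B < cmod (\<phi> q0) ^ k * cmod (b q0)"
    by (simp add: power_divide pos_divide_less_eq mult.commute)
  define \<psi> where "\<psi> q = \<phi> q ^ k * b q" for q
  have c\<psi>: "continuous_on (cball p \<rho>) \<psi>"
    unfolding \<psi>_def by (intro continuous_intros c\<phi> cb)
  have XB: "X \<subseteq> cball p \<rho>" by (auto simp: X_def)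
  have q0X: "q0 \<in> X" using q0 by (auto simp: X_def)
  obtain qM where qM: "qM \<in> X" "\<And>q. q \<in> X \<Longrightarrow> cmod (\<psi> q) \<le> cmod (\<psi> qM)"
    using continuous_attains_sup[OF X, of "\<lambda>q. cmod (\<psi> q)"] q0X
      continuous_on_norm[OF continuous_on_subset[OF c\<psi> XB]] by blast
  define M where "M = cmod (\<psi> qM)"
  have M: "s ^ k * B < M"
    using k qM(2)[OF q0X] by (simp add: M_def \<psi>_def norm_mult norm_power)
  have "0 \<le> B" using B[of p] \<rho>(1) by (meson centre_in_cball less_imp_le norm_ge_zero order_trans)
  then have M0: "0 < M" using M s(1) by (meson le_less_trans mult_nonneg_nonneg zero_le_power)
  \<comment> \<open>All maximum points are interior points with \<open>b \<noteq> 0\<close>; \<open>q1\<close> is the one farthest to the right.\<close>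
  define K where "K = {q \<in> X. cmod (\<psi> q) = M}"
  have "closed K"
    unfolding K_def
    by (intro continuous_closed_preimage_constant continuous_on_norm
        continuous_on_subset[OF c\<psi> XB] compact_imp_closed X)
  then have "compact K" using X by (metis (no_types, lifting) K_def closed_Int_compact inf.absorb1 mem_Collect_eq subsetI)
  moreover have "K \<noteq> {}" using qM(1) unfolding K_def M_def by blast
  ultimately obtain q1 where q1: "q1 \<in> K" "\<And>q. q \<in> K \<Longrightarrow> Re (fst q) \<le> Re (fst q1)"
    using continuous_attains_sup[of K "\<lambda>q. Re (fst q)"]
      continuous_on_Re[OF continuous_on_fst[OF continuous_on_id]] by blast
  have q1S: "q1 \<in> S" "q1 \<in> cball p \<rho>" "cmod (\<psi> q1) = M" using q1(1) by (auto simp: K_def X_def)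
  have q1b: "q1 \<in> ball p \<rho>"
  proof (rule ccontr)
    assume "q1 \<notin> ball p \<rho>"
    then have "q1 \<in> S \<inter> sphere p \<rho>" using q1S by auto
    then have "cmod (\<psi> q1) \<le> s ^ k * B"
      unfolding \<psi>_def norm_mult norm_power
      using s q1S B by (intro mult_mono power_mono) auto
    then show False using M q1S(3) by simp
  qed
  have bq1: "partial_snd g q1 \<noteq> 0" using q1S(3) M0 by (auto simp: \<psi>_def b_def)
  have ballN: "ball p \<rho> \<subseteq> N" using \<rho>(2) by auto
  obtain h r where h: "r > 0" "h holomorphic_on ball (fst q1) r" "h (fst q1) = snd q1"
    "\<And>z. z \<in> ball (fst q1) r \<Longrightarrow> (z, h z) \<in> S \<inter> ball p \<rho>"
  proof (rule graph_in_curve[OF S q1S(1) _ F(2) SW open_ball q1b _ _ _ bq1])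
    show "holomorphic2_on g (ball p \<rho>)" using g(1) ballN by (rule holomorphic2_subset)
  qed (use q1b ballN N g(2) in auto)
  define H where "H z = \<psi> (z, h z)" for z
  have "H holomorphic_on ball (fst q1) r"
    unfolding H_def \<psi>_def using h ballN
    by (intro holomorphic_intros holomorphic2_on_graph[OF \<phi>] holomorphic2_on_graph[OF b]) auto
  moreover have "cmod (H z) \<le> cmod (H (fst q1))" if "z \<in> ball (fst q1) r" for z
  proof -
    have "(z, h z) \<in> X" using h(4)[OF that] by (auto simp: X_def)
    then show ?thesis using qM(2) q1S(3) h(3) by (simp add: H_def M_def)
  qed
  ultimately have const: "H constant_on ball (fst q1) r"
    using h(1) by (intro maximum_modulus_principle[of _ _ "ball (fst q1) r" "fst q1"]) auto
  \<comment> \<open>A point of the graph to the right of \<open>q1\<close> is again a maximum point.\<close>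
  define z where "z = fst q1 + of_real (r / 2)"
  have z: "z \<in> ball (fst q1) r" "Re z > Re (fst q1)" using h(1) by (auto simp: z_def dist_norm)
  then have "H z = H (fst q1)" using const h(1) unfolding constant_on_def by fastforce
  then have "(z, h z) \<in> K"
    using h(3) h(4)[OF z(1)] q1S(3) by (auto simp: K_def X_def H_def)
  from q1(2)[OF this] z(2) show False by simp
qed

lemma holomorphic2_UNIV_I:
  assumes "continuous_on UNIV f" "\<And>u. (\<lambda>z. f (z, u)) holomorphic_on UNIV"
    "\<And>z. (\<lambda>u. f (z, u)) holomorphic_on UNIV"
  shows "holomorphic2_on f UNIV"
  using assms by (intro separately_imp_holomorphic2)
    (auto simp: separately_holomorphic_on_def intro: holomorphic_on_imp_differentiable_at)

lemma holomorphic2_UNIV_D: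
  assumes "holomorphic2_on f UNIV"
  shows "continuous_on UNIV f" "(\<lambda>z. f (z, u)) holomorphic_on UNIV"
    "(\<lambda>u. f (z, u)) holomorphic_on UNIV"
proof -
  have *: "separately_holomorphic_on f UNIV" using assms by (rule holomorphic2_imp_separately)
  then show "continuous_on UNIV f" by (simp add: separately_holomorphic_on_def)
  show "(\<lambda>z. f (z, u)) holomorphic_on UNIV" "(\<lambda>u. f (z, u)) holomorphic_on UNIV"
    using * unfolding separately_holomorphic_on_def holomorphic_on_def by force+
qed

section \<open>Embedded curves have no point of maximal norm\<close>

text \<open>For \<open>\<bar>x\<bar> \<le> \<bar>y\<bar>\<close> and \<open>x \<noteq> y\<close> one has \<open>Re \<langle>x, y\<rangle> < \<bar>y\<bar>\<^sup>2\<close>. So at a point of maximal norm the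
  exponential of the linear form \<open>\<langle>\<cdot>, X p\<rangle>\<close> has a strict peak on the curve.\<close>
lemma pure_curve_no_max_of_embedding:
  fixes X :: "'i \<Rightarrow> complex \<times> complex \<Rightarrow> complex"
  assumes S: "pure_curve2 S" and p: "p \<in> S" and I: "finite I"
    and X: "\<And>i. i \<in> I \<Longrightarrow> holomorphic2_on (X i) UNIV"
    and inj: "\<And>q. (\<And>i. i \<in> I \<Longrightarrow> X i q = X i p) \<Longrightarrow> q = p"
    and max: "\<And>q. q \<in> S \<Longrightarrow> (\<Sum>i\<in>I. (cmod (X i q))\<^sup>2) \<le> (\<Sum>i\<in>I. (cmod (X i p))\<^sup>2)"
  shows False
proof -
  define G where "G q = (\<Sum>i\<in>I. X i q * cnj (X i p))" for q
  have "holomorphic2_on (\<lambda>q. exp (G q)) UNIV"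
    unfolding G_def using holomorphic2_UNIV_D[OF X]
    by (intro holomorphic2_UNIV_I continuous_intros holomorphic_intros) auto
  moreover have "cmod (exp (G q)) < cmod (exp (G p))" if q: "q \<in> S" "q \<noteq> p" for q
  proof -
    have pol: "(cmod (a - b))\<^sup>2 = (cmod a)\<^sup>2 + (cmod b)\<^sup>2 - 2 * Re (a * cnj b)" for a b
      unfolding cmod_power2 by (simp add: power2_eq_square algebra_simps)
    obtain i where i: "i \<in> I" "X i q \<noteq> X i p" using inj q(2) by blast
    have "0 < (\<Sum>i\<in>I. (cmod (X i q - X i p))\<^sup>2)"
      using i I by (intro sum_pos2[of I i]) auto
    also have "\<dots> = (\<Sum>i\<in>I. (cmod (X i q))\<^sup>2) + (\<Sum>i\<in>I. (cmod (X i p))\<^sup>2) - 2 * Re (G q)"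
      unfolding pol G_def Re_sum by (simp add: sum.distrib sum_subtractf sum_distrib_left)
    also have "\<dots> \<le> 2 * (\<Sum>i\<in>I. (cmod (X i p))\<^sup>2) - 2 * Re (G q)"
      using max[OF q(1)] by simp
    also have "(\<Sum>i\<in>I. (cmod (X i p))\<^sup>2) = Re (G p)"
      unfolding G_def Re_sum by (intro sum.cong) (simp_all add: cmod_power2, simp add: power2_eq_square)
    finally show ?thesis by simp
  qed
  ultimately show False using pure_curve_no_strict_peak[OF S p] by blast
qed

section \<open>Global functions on the deformed surface\<close>

text \<open>The global function \<open>x\<^sub>m\<close> is \<open>coord_V a m\<close> in the chart \<open>(\<xi>, v)\<close> and \<open>coord_U a k (k - m)\<close> in the
  chart \<open>(z, u)\<close>: in each chart the recursion starts from the fibre coordinate, so it runs in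
  opposite directions. Both are Horner schemes.\<close>
primrec coord_U :: "(nat \<Rightarrow> complex) \<Rightarrow> nat \<Rightarrow> nat \<Rightarrow> complex \<times> complex \<Rightarrow> complex" where
  "coord_U a k 0 p = snd p"
| "coord_U a k (Suc j) p = fst p * coord_U a k j p + a (k - 1 - j)"

primrec coord_V :: "(nat \<Rightarrow> complex) \<Rightarrow> nat \<Rightarrow> complex \<times> complex \<Rightarrow> complex" where
  "coord_V a 0 q = snd q"
| "coord_V a (Suc m) q = fst q * (coord_V a m q - a m)"

lemma holomorphic2_coord_U: "holomorphic2_on (coord_U a k j) UNIV"
proof -
  have "continuous_on UNIV (coord_U a k j)"
    by (induction j) (auto intro!: continuous_intros)
  moreover have "(\<lambda>z. coord_U a k j (z, u)) holomorphic_on UNIV" for u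
    by (induction j) (auto intro!: holomorphic_intros)
  moreover have "(\<lambda>u. coord_U a k j (z, u)) holomorphic_on UNIV" for z
    by (induction j) (auto intro!: holomorphic_intros)
  ultimately show ?thesis by (rule holomorphic2_UNIV_I)
qed

lemma holomorphic2_coord_V: "holomorphic2_on (coord_V a m) UNIV"
proof -
  have "continuous_on UNIV (coord_V a m)"
    by (induction m) (auto intro!: continuous_intros)
  moreover have "(\<lambda>z. coord_V a m (z, u)) holomorphic_on UNIV" for u
    by (induction m) (auto intro!: holomorphic_intros)
  moreover have "(\<lambda>u. coord_V a m (z, u)) holomorphic_on UNIV" for z
    by (induction m) (auto intro!: holomorphic_intros)
  ultimately show ?thesis by (rule holomorphic2_UNIV_I)
qed

lemma coord_U_closed_form:
  assumes "j \<le> k"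
  shows "coord_U a k j (z, u) = z ^ j * u + (\<Sum>i = k - j..<k. a i * z ^ (i - (k - j)))"
  using assms
proof (induction j)
  case 0
  then show ?case by simp
next
  case (Suc j)
  have k: "k - j = Suc (k - Suc j)" using Suc.prems by simp
  have "(\<Sum>i = k - Suc j..<k. a i * z ^ (i - (k - Suc j)))
      = a (k - Suc j) + (\<Sum>i = k - j..<k. a i * z ^ (i - (k - Suc j)))"
    using Suc.prems k by (subst sum.atLeast_Suc_lessThan) auto
  also have "(\<Sum>i = k - j..<k. a i * z ^ (i - (k - Suc j)))
      = (\<Sum>i = k - j..<k. z * (a i * z ^ (i - (k - j))))"
  proof (rule sum.cong)
    fix i assume "i \<in> {k - j..<k}"
    then have "i - (k - Suc j) = Suc (i - (k - j))" using k by auto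
    then show "a i * z ^ (i - (k - Suc j)) = z * (a i * z ^ (i - (k - j)))" by simp
  qed simp
  finally show ?case using Suc by (simp add: algebra_simps sum_distrib_left)
qed

text \<open>Only the start \<open>m = 0\<close> needs the closed form: \<open>v = z\<^sup>k u + \<Sum> t\<^sub>i z\<^sup>i\<close>. Each further step divides
  by \<open>z\<close> after subtracting the constant term.\<close>
lemma coord_V_transition:
  assumes "m \<le> k" "z \<noteq> 0" "a 0 = 0" and a: "\<And>i. i \<noteq> 0 \<Longrightarrow> a i = t i"
  shows "coord_V a m (transition k t (z, u)) = coord_U a k (k - m) (z, u)"
  using assms(1)
proof (induction m)
  case 0
  have "(\<Sum>i = 0..<k. a i * z ^ i) = (\<Sum>i = 1..k - 1. t i * z ^ i)"
    using assms(3) a by (intro sum.mono_neutral_cong_right) (auto simp: Suc_le_eq)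
  then show ?case by (simp add: coord_U_closed_form transition_def)
next
  case (Suc m)
  have "k - m = Suc (k - Suc m)" "k - 1 - (k - Suc m) = m" using Suc.prems by auto
  then have "coord_U a k (k - m) (z, u) = z * coord_U a k (k - Suc m) (z, u) + a m" by simp
  then show ?case using Suc assms(2) by (simp add: transition_def)
qed

text \<open>If the first coordinates differ, then \<open>x\<^sub>m = z x\<^sub>m\<^sub>+\<^sub>1 + a\<^sub>m\<close> at both points forces
  \<open>x\<^sub>m\<^sub>+\<^sub>1 = 0\<close> for \<open>m < k\<close>, and then \<open>a\<^sub>m = 0\<close> for \<open>0 < m < k\<close>.\<close>
lemma coord_U_inj:
  assumes a: "0 < i" "i < k" "a i \<noteq> 0"
    and eq: "\<And>j. j \<le> k \<Longrightarrow> coord_U a k j q = coord_U a k j p"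
  shows "q = p"
proof -
  have "fst q = fst p"
  proof (rule ccontr)
    assume ne: "fst q \<noteq> fst p"
    have zero: "coord_U a k j p = 0" if "j < k" for j
      using eq[of j] eq[of "Suc j"] that ne by simp
    have "coord_U a k (Suc (k - 1 - i)) p = 0" "coord_U a k (k - 1 - i) p = 0"
      by (rule zero; use a in simp)+
    moreover have "k - 1 - (k - 1 - i) = i" using a by simp
    ultimately show False using a(3) by simp
  qed
  then show ?thesis using eq[of 0] by (simp add: prod_eq_iff)
qed

text \<open>If the first coordinates differ, then \<open>x\<^sub>m\<^sub>+\<^sub>1 = \<xi> (x\<^sub>m - a\<^sub>m)\<close> at both points forces
  \<open>x\<^sub>m = a\<^sub>m\<close> and \<open>x\<^sub>m\<^sub>+\<^sub>1 = 0\<close> for \<open>m < k\<close>, hence \<open>a\<^sub>m = 0\<close> for \<open>0 < m < k\<close>.\<close>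
lemma coord_V_inj:
  assumes a: "0 < i" "i < k" "a i \<noteq> 0"
    and eq: "\<And>m. m \<le> k \<Longrightarrow> coord_V a m q = coord_V a m p"
  shows "q = p"
proof -
  have "fst q = fst p"
  proof (rule ccontr)
    assume ne: "fst q \<noteq> fst p"
    have val: "coord_V a m p = a m" if "m < k" for m
      using eq[of m] eq[of "Suc m"] that ne by simp
    obtain m where m: "i = Suc m" using a(1) by (cases i) auto
    show False using val[of i] val[of m] a m by simp
  qed
  then show ?thesis using eq[of 0] by (simp add: prod_eq_iff)
qed

section \<open>Compact curves\<close>

text \<open>The function \<open>\<Sum> \<bar>x\<^sub>m\<bar>\<^sup>2\<close> on the surface. The transition map has no term of degree zero, so the
  coefficient sequence of the recursions is \<open>t\<close> with value \<open>0\<close> at \<open>0\<close>.\<close>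
definition embedding_norm ::
    "nat \<Rightarrow> (nat \<Rightarrow> complex) \<Rightarrow> glued_point \<Rightarrow> real" where
  "embedding_norm k t c = (let a = t(0 := 0) in
     if c \<in> range (chart_U k t)
     then \<Sum>j\<le>k. (cmod (coord_U a k j (inv (chart_U k t) c)))\<^sup>2
     else \<Sum>m\<le>k. (cmod (coord_V a m (inv (chart_V k t) c)))\<^sup>2)"

lemma embedding_norm_chart_U:
  "embedding_norm k t (chart_U k t p) = (\<Sum>j\<le>k. (cmod (coord_U (t(0 := 0)) k j p))\<^sup>2)"
proof -
  have "inj (chart_U k t)" by (auto simp: inj_def chart_eq_iff)
  then show ?thesis by (simp add: embedding_norm_def)
qed

lemma embedding_norm_chart_V:
  "embedding_norm k t (chart_V k t q) = (\<Sum>m\<le>k. (cmod (coord_V (t(0 := 0)) m q))\<^sup>2)"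
proof (cases "chart_V k t q \<in> range (chart_U k t)")
  case False
  have "inj (chart_V k t)" by (auto simp: inj_def chart_eq_iff)
  then show ?thesis using False by (simp add: embedding_norm_def)
next
  case True
  then obtain p where p: "chart_U k t p = chart_V k t q" by fastforce
  then have z: "fst p \<noteq> 0" and q: "q = transition k t (fst p, snd p)"
    by (auto simp: chart_eq_iff)
  have "embedding_norm k t (chart_V k t q) = (\<Sum>j\<le>k. (cmod (coord_U (t(0 := 0)) k j p))\<^sup>2)"
    by (simp only: p[symmetric] embedding_norm_chart_U)
  also have "\<dots> = (\<Sum>m\<le>k. (cmod (coord_U (t(0 := 0)) k (k - m) p))\<^sup>2)"
    by (rule sum.nat_diff_reindex[symmetric, of _ "Suc k", simplified lessThan_Suc_atMost, simplified])
  also have "\<dots> = (\<Sum>m\<le>k. (cmod (coord_V (t(0 := 0)) m q))\<^sup>2)"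
    unfolding q using z coord_V_transition[of _ k "fst p" "t(0 := 0)" t "snd p"]
    by (intro sum.cong) auto
  finally show ?thesis .
qed

lemma continuous_map_embedding_norm:
  "continuous_map (deformed_surface k t) euclideanreal (embedding_norm k t)"
proof -
  have "continuous_on UNIV (coord_U a k j)" "continuous_on UNIV (coord_V a j)" for a j
    using holomorphic2_coord_U holomorphic2_coord_V holomorphic2_continuous by blast+
  then have cont: "continuous_on UNIV (\<lambda>p. embedding_norm k t (chart_U k t p))"
      "continuous_on UNIV (\<lambda>q. embedding_norm k t (chart_V k t q))"
    unfolding embedding_norm_chart_U embedding_norm_chart_V by (intro continuous_intros; simp)+
  have "openin (deformed_surface k t)
      {c \<in> topspace (deformed_surface k t). embedding_norm k t c \<in> A}" if "open A" for A
  proof -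
    have "chart_U k t -` {c \<in> topspace (deformed_surface k t). embedding_norm k t c \<in> A}
        = (\<lambda>p. embedding_norm k t (chart_U k t p)) -` A"
      "chart_V k t -` {c \<in> topspace (deformed_surface k t). embedding_norm k t c \<in> A}
        = (\<lambda>q. embedding_norm k t (chart_V k t q)) -` A"
      by (auto simp: deformed_surface_charts_cover)
    moreover have "open ((\<lambda>p. embedding_norm k t (chart_U k t p)) -` A)"
      "open ((\<lambda>q. embedding_norm k t (chart_V k t q)) -` A)"
      using cont that by (auto intro: open_vimage)
    ultimately show ?thesis
      unfolding openin_deformed_surface by (auto simp: topspace_deformed_surface)
  qed
  then show ?thesis by (simp add: continuous_map_def)
qed

theorem theorem6p6:
  fixes k :: nat and t :: "nat \<Rightarrow> complex"
  assumes "k \<ge> 2" and "nontrivial_deformation k t"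
  shows "\<not> (\<exists>C. analytic_curve_in k t C \<and> compactin (deformed_surface k t) C)"
proof
  assume "\<exists>C. analytic_curve_in k t C \<and> compactin (deformed_surface k t) C"
  then obtain C where C: "analytic_curve_in k t C" "compactin (deformed_surface k t) C" by blast
  define a where "a = t(0 := 0)"
  obtain i where i': "i \<in> {1..k - 1}" "t i \<noteq> 0"
    using assms(2) unfolding nontrivial_deformation_def by blast
  then have i: "0 < i" "i < k" "a i \<noteq> 0" using assms(1) by (auto simp: a_def)
  have pure: "pure_curve2 (chart_U k t -` C)" "pure_curve2 (chart_V k t -` C)"
    and "C \<noteq> {}" and CT: "C \<subseteq> topspace (deformed_surface k t)"
    using C(1) by (auto simp: analytic_curve_in_def)
  have "compact (embedding_norm k t ` C)"
    using image_compactin[OF C(2) continuous_map_embedding_norm] by simp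
  then obtain c where c: "c \<in> C" "\<And>c'. c' \<in> C \<Longrightarrow> embedding_norm k t c' \<le> embedding_norm k t c"
    using compact_attains_sup[of "embedding_norm k t ` C"] \<open>C \<noteq> {}\<close> by auto
  then consider p where "c = chart_U k t p" | q where "c = chart_V k t q"
    using CT deformed_surface_charts_cover by blast
  then show False
  proof cases
    case 1
    show False
    proof (rule pure_curve_no_max_of_embedding[OF pure(1), of p "{..k}" "coord_U a k"])
      show "(\<Sum>j\<in>{..k}. (cmod (coord_U a k j q))\<^sup>2) \<le> (\<Sum>j\<in>{..k}. (cmod (coord_U a k j p))\<^sup>2)"
        if "q \<in> chart_U k t -` C" for q
        using c(2)[of "chart_U k t q"] that by (simp add: 1 embedding_norm_chart_U a_def)
    qed (use c(1) 1 holomorphic2_coord_U coord_U_inj[where a = a and k = k, OF i] in auto)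
  next
    case 2
    show False
    proof (rule pure_curve_no_max_of_embedding[OF pure(2), of q "{..k}" "coord_V a"])
      show "(\<Sum>m\<in>{..k}. (cmod (coord_V a m q'))\<^sup>2) \<le> (\<Sum>m\<in>{..k}. (cmod (coord_V a m q))\<^sup>2)"
        if "q' \<in> chart_V k t -` C" for q'
        using c(2)[of "chart_V k t q'"] that by (simp add: 2 embedding_norm_chart_V a_def)
    qed (use c(1) 2 holomorphic2_coord_V coord_V_inj[where a = a and k = k, OF i] in auto)
  qed
qed

end
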